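(* Let $I$ be a finite set and $T$ a tree on $I$. For $i\in I$ put $$\theta_i=\sum_{j\geq_T i}\Big(\prod_{k<_T i}(x_k-x_j)\Big)\partial_j,\qquad \omega_i=\sum_{j\leq_T i}\Big(\prod_{k\leq_T i,\ k\neq j}\frac{1}{x_k-x_j}\Big)dx_j .$$ Then the set of logarithmic $1$-forms $(\omega_i)_{i\in I}$ is the basis of the module of logarithmic $1$-forms of $H_T$ dual to the basis $(\theta_i)_{i\in I}$ of $\operatorname{Der}(H_T)$; that is, $\langle\omega_i,\theta_{i'}\rangle=\delta_{i,i'}$ for all $i,i'\in I$.
   Context: A tree on a finite set $I$ is a labeled rooted tree with vertex set $I$; equivalently, a partial order $\leq_T$ on $I$ with a unique minimal element (the root) such that the interval between the root and any element is a chain. $\mathbb{C}^I$ has coordinates $x_i$, and $\partial_j=\partial/\partial x_j$. $H_T$ is the hyperplane arrangement in $\mathbb{C}^I$ consisting of the hyperplanes $x_i=x_j$ for $i<_T j$, and $\mathsf{Q}_T=\prod_{i<_T j}(x_i-x_j)$. $\operatorname{Der}(H_T)$ is the module, over the ring $\mathbb{C}[x_i:i\in I]$, of polynomial vector fields $\theta$ on $\mathbb{C}^I$ such that $\alpha$ divides $\theta(\alpha)$ for each $\alpha=x_i-x_j$ with $i<_T j$; it is free with basis $(\theta_i)_{i\in I}$. A $1$-form $\omega$ with rational function coefficients on $\mathbb{C}^I$ is logarithmic for $H_T$ if $\mathsf{Q}_T\,\omega$ and $\mathsf{Q}_T\,d\omega$ are polynomial forms. The module of logarithmic $1$-forms over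 the polynomial ring is in duality with $\operatorname{Der}(H_T)$ by the restriction of the usual pairing $\langle\,,\rangle$ between $1$-forms and vector fields (with $\langle dx_i,\partial_j\rangle=\delta_{i,j}$). *)

theory Defs
  imports
    "HOL-Library.Poly_Mapping"
    "HOL-Library.Countable"
    "HOL-Computational_Algebra.Fraction_Field"
    "HOL-Analysis.Finite_Cartesian_Product"
begin

section \<open>Polynomials and rational functions in variables indexed by a finite type\<close>

text \<open>
  A polynomial is a finitely supported map from monomials to coefficients. The library makes
  \<open>'k \<Rightarrow>\<^sub>0 complex\<close> an integral domain as soon as \<open>'k\<close> is a linearly ordered cancellative monoid.
  The monomials in the variables \<open>'i\<close> are therefore wrapped in a type that carries some monomial
  order. That order is a technical device; it lets the variables be indexed by any finite type,
  ordered or not.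
\<close>

typedef 'i monom = "UNIV :: ('i \<Rightarrow> nat) set"
  morphisms exponent Monom ..

setup_lifting type_definition_monom

instantiation monom :: (type) cancel_comm_monoid_add
begin

lift_definition zero_monom :: "'i monom" is "\<lambda>_. 0" .
lift_definition plus_monom :: "'i monom \<Rightarrow> 'i monom \<Rightarrow> 'i monom" is "\<lambda>m n i. m i + n i" .
lift_definition minus_monom :: "'i monom \<Rightarrow> 'i monom \<Rightarrow> 'i monom" is "\<lambda>m n i. m i - n i" .

instance
  by (intro_classes; transfer; auto simp: fun_eq_iff)

end

definition order_key :: "'i::finite monom \<Rightarrow> (nat \<Rightarrow>\<^sub>0 nat)" where
  "order_key m = (\<Sum>i\<in>UNIV. Poly_Mapping.single (to_nat i) (exponent m i))"

lemma lookup_order_key: "Poly_Mapping.lookup (order_key m) (to_nat i) = exponent m i"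
  by (simp add: order_key_def lookup_sum lookup_single when_def inj_eq)

lemma order_key_inject: "order_key m = order_key n \<longleftrightarrow> m = n"
  by (metis exponent_inject ext lookup_order_key)

lemma order_key_add: "order_key (m + n) = order_key m + order_key n"
  by (simp add: order_key_def plus_monom.rep_eq single_add sum.distrib)

instantiation monom :: (finite) "{linorder, ordered_cancel_comm_monoid_add}"
begin

definition "m \<le> n \<longleftrightarrow> order_key m \<le> order_key n" for m n :: "'a monom"
definition "m < n \<longleftrightarrow> order_key m < order_key n" for m n :: "'a monom"

instance
  by intro_classes
    (auto simp: less_eq_monom_def less_monom_def order_key_add add_left_mono
      simp flip: order_key_inject)

end

type_synonym 'i cpoly = "'i monom \<Rightarrow>\<^sub>0 complex"
type_synonym 'i ratfun = "'i cpoly fract"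

lift_definition unit_monom :: "'i \<Rightarrow> 'i monom" is "\<lambda>i j. if j = i then 1 else 0" .

definition Var :: "'i::finite \<Rightarrow> 'i cpoly" where
  "Var i = Poly_Mapping.single (unit_monom i) 1"

definition rat_of :: "'i::finite cpoly \<Rightarrow> 'i ratfun" where
  "rat_of p = Fraction_Field.Fract p 1"

lemma rat_of_one [simp]: "rat_of 1 = 1"
  by (simp add: rat_of_def Fraction_Field.One_fract_def)

lemma rat_of_add: "rat_of (p + q) = rat_of p + rat_of q"
  by (simp add: rat_of_def)

lemma rat_of_mult: "rat_of (p * q) = rat_of p * rat_of q"
  by (simp add: rat_of_def)


section \<open>Partial derivatives\<close>

lift_definition pdiff :: "'i::finite \<Rightarrow> 'i cpoly \<Rightarrow> 'i cpoly"
  is "\<lambda>i p m. of_nat (exponent m i + 1) * p (m + unit_monom i)"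
proof -
  fix i :: 'i and p :: "'i monom \<Rightarrow> complex"
  assume "finite {m. p m \<noteq> 0}"
  then have "finite ((\<lambda>m. m + unit_monom i) -` {m. p m \<noteq> 0})"
    by (rule finite_vimageI) (simp add: inj_def)
  then show "finite {m. of_nat (exponent m i + 1) * p (m + unit_monom i) \<noteq> 0}"
    by (rule rev_finite_subset) auto
qed

lemma pdiff_add: "pdiff i (p + q) = pdiff i p + pdiff i q"
  by (rule poly_mapping_eqI) (simp add: pdiff.rep_eq lookup_add distrib_left)

lemma pdiff_zero [simp]: "pdiff i 0 = 0"
  by (rule poly_mapping_eqI) (simp add: pdiff.rep_eq)

lemma pdiff_single:
  "pdiff i (Poly_Mapping.single m c)
    = Poly_Mapping.single (m - unit_monom i) (of_nat (exponent m i) * c)"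
proof (rule poly_mapping_eqI)
  fix k
  show "Poly_Mapping.lookup (pdiff i (Poly_Mapping.single m c)) k =
    Poly_Mapping.lookup (Poly_Mapping.single (m - unit_monom i) (of_nat (exponent m i) * c)) k"
  proof (cases "exponent m i = 0")
    case True
    then have "m \<noteq> k + unit_monom i"
      by (auto simp: plus_monom.rep_eq unit_monom.rep_eq)
    with True show ?thesis
      by (simp add: pdiff.rep_eq lookup_single)
  next
    case False
    then have "m = k + unit_monom i \<longleftrightarrow> m - unit_monom i = k"
      by transfer (auto simp: fun_eq_iff)
    moreover have "exponent (k + unit_monom i) i = exponent k i + 1"
      by transfer simp
    ultimately show ?thesis
      by (auto simp: pdiff.rep_eq lookup_single when_def)
  qed
qed

lemma pdiff_Var: "pdiff i (Var j) = (if i = j then 1 else 0)"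
  by (simp add: Var_def pdiff_single unit_monom.rep_eq single_one)

lemma pdiff_mult_single:
  "pdiff i (Poly_Mapping.single m c * Poly_Mapping.single n d)
    = pdiff i (Poly_Mapping.single m c) * Poly_Mapping.single n d
      + Poly_Mapping.single m c * pdiff i (Poly_Mapping.single n d)"
proof -
  have 1: "Poly_Mapping.single (m + n - unit_monom i) (of_nat (exponent m i) * e)
      = Poly_Mapping.single (m - unit_monom i + n) (of_nat (exponent m i) * e)" for e :: complex
  proof (cases "exponent m i = 0")
    case False
    then have "m + n - unit_monom i = m - unit_monom i + n"
      by transfer (auto simp: fun_eq_iff)
    then show ?thesis by simp
  qed simp
  have 2: "Poly_Mapping.single (m + n - unit_monom i) (of_nat (exponent n i) * e)
      = Poly_Mapping.single (m + (n - unit_monom i)) (of_nat (exponent n i) * e)" for e :: complex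
  proof (cases "exponent n i = 0")
    case False
    then have "m + n - unit_monom i = m + (n - unit_monom i)"
      by transfer (auto simp: fun_eq_iff)
    then show ?thesis by simp
  qed simp
  show ?thesis
    using 1[of "c * d"] 2[of "c * d"]
    by (simp add: pdiff_single mult_single plus_monom.rep_eq distrib_left distrib_right single_add
        ac_simps)
qed

lemma cpoly_induct:
  fixes p :: "'i::finite cpoly"
  assumes "P 0" and "\<And>m c p. P p \<Longrightarrow> P (Poly_Mapping.single m c + p)"
  shows "P p"
proof -
  have "P (\<Sum>m\<in>A. Poly_Mapping.single m (Poly_Mapping.lookup p m))" if "finite A" for A
    using that by induction (auto intro: assms)
  moreover have "(\<Sum>m\<in>Poly_Mapping.keys p. Poly_Mapping.single m (Poly_Mapping.lookup p m)) = p"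
    by (rule poly_mapping_eqI) (auto simp: lookup_sum lookup_single when_def in_keys_iff)
  ultimately show ?thesis
    by (metis finite_keys)
qed

lemma pdiff_mult: "pdiff i (p * q) = pdiff i p * q + p * pdiff i q"
proof (induction p rule: cpoly_induct)
  case (2 m c p)
  have "pdiff i (Poly_Mapping.single m c * q)
      = pdiff i (Poly_Mapping.single m c) * q + Poly_Mapping.single m c * pdiff i q"
    by (induction q rule: cpoly_induct) (simp_all add: distrib_left pdiff_add pdiff_mult_single)
  with 2 show ?case
    by (simp add: distrib_right pdiff_add)
qed simp

lift_definition rdiff :: "'i::finite \<Rightarrow> 'i ratfun \<Rightarrow> 'i ratfun"
  is "\<lambda>i (a, b). (pdiff i a * b - a * pdiff i b, b * b)"
proof -
  fix i :: 'i and x y :: "'i cpoly \<times> 'i cpoly"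
  obtain a b where x: "x = (a, b)" by (cases x)
  obtain c d where y: "y = (c, d)" by (cases y)
  assume "fractrel x y"
  with x y have nz: "b \<noteq> 0" "d \<noteq> 0" and eq: "a * d = c * b"
    by auto
  have deq: "pdiff i a * d + a * pdiff i d = pdiff i c * b + c * pdiff i b"
    using arg_cong[OF eq, of "pdiff i"] by (simp add: pdiff_mult)
  have "(pdiff i a * b - a * pdiff i b) * (d * d) = (pdiff i c * d - c * pdiff i d) * (b * b)"
    using eq deq by algebra
  with nz x y show "fractrel (case x of (a, b) \<Rightarrow> (pdiff i a * b - a * pdiff i b, b * b))
      (case y of (a, b) \<Rightarrow> (pdiff i a * b - a * pdiff i b, b * b))"
    by simp
qed

lemma rdiff_Fract:
  "b \<noteq> 0 \<Longrightarrow> rdiff i (Fraction_Field.Fract a b) = Fraction_Field.Fract (pdiff i a * b - a * pdiff i b) (b * b)"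
  by (simp add: Fraction_Field.Fract.abs_eq rdiff.abs_eq)


section \<open>Vector fields and differential forms\<close>

text \<open>The components of \<open>\<theta>\<close> and \<open>\<omega>\<close> are the coefficients of \<open>\<partial>\<^sub>j\<close> and \<open>dx\<^sub>j\<close>.\<close>

type_synonym 'i vfield = "'i cpoly ^ 'i"
type_synonym 'i form1 = "'i ratfun ^ 'i"

definition apply_vf :: "'i::finite vfield \<Rightarrow> 'i cpoly \<Rightarrow> 'i cpoly" where
  "apply_vf \<theta> p = (\<Sum>j\<in>UNIV. \<theta> $ j * pdiff j p)"

definition pairing :: "'i::finite form1 \<Rightarrow> 'i vfield \<Rightarrow> 'i ratfun" where
  "pairing \<omega> \<theta> = (\<Sum>j\<in>UNIV. \<omega> $ j * rat_of (\<theta> $ j))"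

text \<open>
  A 2-form is given by its antisymmetric matrix of coefficients: the entry at \<open>(i, j)\<close> is the
  coefficient of \<open>dx\<^sub>i \<and> dx\<^sub>j\<close> for \<open>i \<noteq> j\<close>.
\<close>

definition ext_deriv :: "'i::finite form1 \<Rightarrow> 'i ratfun ^ 'i ^ 'i" where
  "ext_deriv \<omega> = (\<chi> i j. rdiff i (\<omega> $ j) - rdiff j (\<omega> $ i))"

definition form_scale :: "'i::finite cpoly \<Rightarrow> 'i form1 \<Rightarrow> 'i form1" where
  "form_scale p \<omega> = rat_of p *s \<omega>"

definition (in module) family_basis :: "('i \<Rightarrow> 'b) \<Rightarrow> 'b set \<Rightarrow> bool" where
  "family_basis b M \<longleftrightarrow> inj b \<and> independent (range b) \<and> span (range b) = M"

interpretation vf: module "(*s) :: 'i::finite cpoly \<Rightarrow> 'i vfield \<Rightarrow> 'i vfield"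
  by unfold_locales (simp_all add: vector_add_ldistrib vector_sadd_rdistrib vector_smult_assoc)

interpretation form: module "form_scale :: 'i::finite cpoly \<Rightarrow> 'i form1 \<Rightarrow> 'i form1"
  by unfold_locales
    (simp_all add: form_scale_def rat_of_add rat_of_mult vector_add_ldistrib vector_sadd_rdistrib
      vector_smult_assoc)


section \<open>Trees and their arrangements\<close>

definition minimal_in :: "'i rel \<Rightarrow> 'i \<Rightarrow> bool" where
  "minimal_in T r \<longleftrightarrow> (\<forall>k. (k, r) \<in> T \<longrightarrow> k = r)"

definition tree_order :: "'i rel \<Rightarrow> bool" where
  "tree_order T \<longleftrightarrow> partial_order_on UNIV T \<and> (\<exists>!r. minimal_in T r) \<and>
    (\<forall>r i. minimal_in T r \<longrightarrow> {k. (r, k) \<in> T \<and> (k, i) \<in> T} \<in> Chains T)"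

abbreviation (input) tree_le :: "'i \<Rightarrow> 'i rel \<Rightarrow> 'i \<Rightarrow> bool" ("(_ \<preceq>\<^bsub>_\<^esub> _)" [51, 0, 51] 50) where
  "i \<preceq>\<^bsub>T\<^esub> j \<equiv> (i, j) \<in> T"

abbreviation (input) tree_less :: "'i \<Rightarrow> 'i rel \<Rightarrow> 'i \<Rightarrow> bool" ("(_ \<prec>\<^bsub>_\<^esub> _)" [51, 0, 51] 50) where
  "i \<prec>\<^bsub>T\<^esub> j \<equiv> (i, j) \<in> T \<and> i \<noteq> j"

definition Q_poly :: "'i::finite rel \<Rightarrow> 'i cpoly" where
  "Q_poly T = (\<Prod>(i, j) \<in> {(i, j). i \<prec>\<^bsub>T\<^esub> j}. Var i - Var j)"

definition Der :: "'i::finite rel \<Rightarrow> 'i vfield set" where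
  "Der T = {\<theta>. \<forall>i j. i \<prec>\<^bsub>T\<^esub> j \<longrightarrow> Var i - Var j dvd apply_vf \<theta> (Var i - Var j)}"

definition log_forms :: "'i::finite rel \<Rightarrow> 'i form1 set" where
  "log_forms T = {\<omega>. (\<forall>j. rat_of (Q_poly T) * \<omega> $ j \<in> range rat_of) \<and>
    (\<forall>i j. rat_of (Q_poly T) * ext_deriv \<omega> $ i $ j \<in> range rat_of)}"

definition theta :: "'i::finite rel \<Rightarrow> 'i \<Rightarrow> 'i vfield" where
  "theta T i = (\<chi> j. if i \<preceq>\<^bsub>T\<^esub> j then \<Prod>k | k \<prec>\<^bsub>T\<^esub> i. Var k - Var j else 0)"

definition omega :: "'i::finite rel \<Rightarrow> 'i \<Rightarrow> 'i form1" where
  "omega T i = (\<chi> j. if j \<preceq>\<^bsub>T\<^esub> i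
     then \<Prod>k | k \<preceq>\<^bsub>T\<^esub> i \<and> k \<noteq> j. 1 / (rat_of (Var k) - rat_of (Var j)) else 0)"

end

theory Submission
  imports Defs "HOL-Analysis.Cartesian_Space"
begin

text \<open>
  Along the chain from \<open>i'\<close> to \<open>i\<close> the pairing \<open>\<langle>\<omega>\<^sub>i, \<theta>\<^bsub>i'\<^esub>\<rangle>\<close> telescopes to
  \<open>\<Sum>\<^sub>j \<Prod>\<^sub>k\<^sub>\<noteq>\<^sub>j 1/(x\<^sub>k - x\<^sub>j)\<close>, the divided difference of the constant \<open>1\<close>, which vanishes unless
  the chain has a single element; so the coefficient matrices of the two families are inverse to
  each other over the rational functions. Every vector field \<open>\<theta>\<close> is then
  \<open>\<Sum> \<langle>\<omega>\<^sub>i, \<theta>\<rangle> \<theta>\<^sub>i\<close> and every form \<open>\<omega>\<close> is \<open>\<Sum> \<langle>\<omega>, \<theta>\<^sub>i\<rangle> \<omega>\<^sub>i\<close>. These coefficients are polynomial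
  because the pairing of any logarithmic form with any element of \<open>Der(H\<^sub>T)\<close> is: modulo each
  \<open>x\<^sub>a - x\<^sub>b\<close> the numerator of the form is a multiple of \<open>dx\<^sub>a - dx\<^sub>b\<close>.
\<close>

section \<open>Divisibility by differences of variables\<close>

text \<open>The action on monomials of the substitution performed by
  \<open>identify\<close>.\<close>

lift_definition merge_monom :: "'i \<Rightarrow> 'i \<Rightarrow> 'i monom \<Rightarrow> 'i monom"
  is "\<lambda>a b m i. if i = a then 0 else if i = b then m a + m b else m i" .

lemma merge_monom_zero: "merge_monom a b 0 = 0"
  by transfer auto

lemma merge_monom_add: "merge_monom a b (m + n) = merge_monom a b m + merge_monom a b n"
  by transfer (auto simp: fun_eq_iff)

lemma merge_unit_monom:
  "a \<noteq> b \<Longrightarrow> merge_monom a b (unit_monom c) = unit_monom (if c = a then b else c)"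
  by transfer (auto simp: fun_eq_iff)

text \<open>The substitution \<open>x\<^sub>a := x\<^sub>b\<close>. For \<open>a \<noteq> b\<close> its kernel is the ideal generated by
  \<open>x\<^sub>a - x\<^sub>b\<close>, which is therefore prime. (For \<open>a = b\<close> it sends \<open>x\<^sub>a\<close> to \<open>1\<close>.)\<close>

definition identify :: "'i::finite \<Rightarrow> 'i \<Rightarrow> 'i cpoly \<Rightarrow> 'i cpoly" where
  "identify a b p = (\<Sum>m\<in>Poly_Mapping.keys p.
     Poly_Mapping.single (merge_monom a b m) (Poly_Mapping.lookup p m))"

text \<open>Two polynomials can thus be summed over one common support, which gives additivity of
  \<open>identify\<close>.\<close>

lemma identify_superset:
  assumes "finite A" "Poly_Mapping.keys p \<subseteq> A"
  shows "identify a b p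
    = (\<Sum>m\<in>A. Poly_Mapping.single (merge_monom a b m) (Poly_Mapping.lookup p m))"
  unfolding identify_def using assms
  by (intro sum.mono_neutral_left) (auto simp: in_keys_iff)

lemma identify_zero [simp]: "identify a b 0 = 0"
  by (simp add: identify_def)

lemma identify_single:
  "identify a b (Poly_Mapping.single m c) = Poly_Mapping.single (merge_monom a b m) c"
  by (cases "c = 0") (simp_all add: identify_def)

lemma identify_add: "identify a b (p + q) = identify a b p + identify a b q"
proof -
  let ?A = "Poly_Mapping.keys p \<union> Poly_Mapping.keys q"
  have "Poly_Mapping.keys (p + q) \<subseteq> ?A"
    by (rule Poly_Mapping.keys_add)
  then show ?thesis
    by (simp add: identify_superset[of ?A] lookup_add single_add sum.distrib)
qed

lemma identify_diff: "identify a b (p - q) = identify a b p - identify a b q"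
  using identify_add[of a b "p - q" q] by (simp add: algebra_simps)

lemma identify_mult: "identify a b (p * q) = identify a b p * identify a b q"
proof (induction p rule: cpoly_induct)
  case (2 m c p)
  have "identify a b (Poly_Mapping.single m c * q)
      = identify a b (Poly_Mapping.single m c) * identify a b q"
    by (induction q rule: cpoly_induct)
      (simp_all add: distrib_left identify_add mult_single identify_single merge_monom_add)
  with 2 show ?case
    by (simp add: distrib_right identify_add)
qed simp

lemma identify_one [simp]: "identify a b 1 = 1"
  by (simp add: identify_single merge_monom_zero flip: single_one)

lemma identify_prod: "identify a b (\<Prod>i\<in>S. f i) = (\<Prod>i\<in>S. identify a b (f i))"
  by (induction S rule: infinite_finite_induct) (simp_all add: identify_mult)

lemma identify_Var: "a \<noteq> b \<Longrightarrow> identify a b (Var c) = Var (if c = a then b else c)"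
  by (simp add: Var_def identify_single merge_unit_monom)

lemma pdiff_diff_Var:
  "pdiff i (Var a - Var b) = (if i = a then 1 else 0) - (if i = b then 1 else 0)"
  using pdiff_add[of i "Var a - Var b" "Var b"] by (simp add: pdiff_Var algebra_simps)

text \<open>The derivative with respect to \<open>x\<^sub>i\<close> tells two variables
  apart.\<close>

lemma Var_eq_iff [simp]: "Var i = Var j \<longleftrightarrow> i = j"
  by (metis pdiff_Var zero_neq_one)

text \<open>Factors \<open>x\<^sub>a\<close> are traded for \<open>x\<^sub>b\<close> one at a time.
  Each trade changes the monomial by a multiple of \<open>Var a - Var b\<close>, and a monomial free
  of \<open>x\<^sub>a\<close> is its own merge.\<close>

lemma dvd_diff_merge_single:
  assumes "a \<noteq> b"
  shows "Var a - Var b dvd Poly_Mapping.single m c - Poly_Mapping.single (merge_monom a b m) c"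
proof (induction "exponent m a" arbitrary: m)
  case 0
  then have "merge_monom a b m = m"
    by transfer (auto simp: fun_eq_iff)
  then show ?case by simp
next
  case (Suc n)
  define m' where "m' = m - unit_monom a"
  have m: "m = m' + unit_monom a"
    using Suc.hyps(2) unfolding m'_def by transfer (auto simp: fun_eq_iff)
  have n: "n = exponent (m' + unit_monom b) a"
    using assms Suc.hyps(2) unfolding m by transfer auto
  have *: "merge_monom a b m = merge_monom a b (m' + unit_monom b)"
    using assms unfolding m by (simp add: merge_monom_add merge_unit_monom)
  have "Poly_Mapping.single m c - Poly_Mapping.single (m' + unit_monom b) c
      = Poly_Mapping.single m' c * (Var a - Var b)"
    by (simp add: m Var_def mult_single right_diff_distrib)
  then have "Var a - Var b dvd
      Poly_Mapping.single m c - Poly_Mapping.single (m' + unit_monom b) c"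
    by simp
  from dvd_add[OF this Suc.hyps(1)[OF n]] show ?case
    by (simp add: *)
qed

text \<open>The substitution kills \<open>Var a - Var b\<close>, and every \<open>p\<close> is
  congruent to its image modulo this difference.\<close>

lemma diff_Var_dvd_iff:
  assumes "a \<noteq> b"
  shows "Var a - Var b dvd p \<longleftrightarrow> identify a b p = 0"
proof
  assume "Var a - Var b dvd p"
  with assms show "identify a b p = 0"
    by (auto simp: dvd_def identify_mult identify_diff identify_Var)
next
  have "Var a - Var b dvd p - identify a b p"
  proof (induction p rule: cpoly_induct)
    case (2 m c p)
    have "Poly_Mapping.single m c + p - identify a b (Poly_Mapping.single m c + p)
        = (Poly_Mapping.single m c - Poly_Mapping.single (merge_monom a b m) c)
          + (p - identify a b p)"
      by (simp add: identify_add identify_single)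
    then show ?case
      using dvd_add[OF dvd_diff_merge_single[OF assms] 2] by (simp only:)
  qed simp
  moreover assume "identify a b p = 0"
  ultimately show "Var a - Var b dvd p"
    by simp
qed

text \<open>Primality: \<open>identify\<close> is multiplicative with values in an integral
  domain.\<close>

lemma diff_Var_dvd_mult_iff:
  "a \<noteq> b \<Longrightarrow> Var a - Var b dvd p * q \<longleftrightarrow> Var a - Var b dvd p \<or> Var a - Var b dvd q"
  by (simp add: diff_Var_dvd_iff identify_mult)

lemma diff_Var_dvd_prod_iff:
  "\<lbrakk>a \<noteq> b; finite S\<rbrakk> \<Longrightarrow> Var a - Var b dvd prod f S \<longleftrightarrow> (\<exists>i\<in>S. Var a - Var b dvd f i)"
  by (simp add: diff_Var_dvd_iff identify_prod)

lemma diff_Var_dvd_diff_Var_iff: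
  "\<lbrakk>a \<noteq> b; c \<noteq> d\<rbrakk> \<Longrightarrow> Var a - Var b dvd Var c - Var d \<longleftrightarrow> {a, b} = {c, d}"
  by (auto simp: diff_Var_dvd_iff identify_diff identify_Var doubleton_eq_iff split: if_splits)

text \<open>The factors are primes, pairwise non-associated because their unordered index pairs
  differ. So a new factor dividing \<open>p\<close> must divide the remaining cofactor
  \<open>q\<close>.\<close>

lemma prod_diff_Var_dvd:
  assumes "finite S" "inj_on (\<lambda>i. {u i, v i}) S" "\<And>i. i \<in> S \<Longrightarrow> u i \<noteq> v i"
    and "\<And>i. i \<in> S \<Longrightarrow> Var (u i) - Var (v i) dvd p"
  shows "(\<Prod>i\<in>S. Var (u i) - Var (v i)) dvd p"
  using assms
proof (induction S)
  case (insert i S)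
  then obtain q where q: "p = (\<Prod>i\<in>S. Var (u i) - Var (v i)) * q"
    by (auto simp: inj_on_insert elim: dvdE)
  have "\<not> Var (u i) - Var (v i) dvd Var (u j) - Var (v j)" if "j \<in> S" for j
    using that insert by (auto simp: diff_Var_dvd_diff_Var_iff inj_on_insert)
  moreover have "Var (u i) - Var (v i) dvd p" and "u i \<noteq> v i"
    using insert by auto
  ultimately have "Var (u i) - Var (v i) dvd q"
    using insert.hyps unfolding q by (auto simp: diff_Var_dvd_mult_iff diff_Var_dvd_prod_iff)
  then show ?case
    using insert.hyps unfolding q by (simp add: mult.commute mult_dvd_mono)
qed simp

section \<open>Rational functions\<close>

lemma rat_of_eq_iff [simp]: "rat_of p = rat_of q \<longleftrightarrow> p = q"
  by (simp add: rat_of_def eq_fract)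

lemma rat_of_zero [simp]: "rat_of 0 = 0"
  by (simp add: rat_of_def fract_collapse)

lemma rat_of_eq_0_iff [simp]: "rat_of p = 0 \<longleftrightarrow> p = 0"
  by (metis rat_of_eq_iff rat_of_zero)

lemma rat_of_diff: "rat_of (p - q) = rat_of p - rat_of q"
  by (simp add: rat_of_def)

lemma rat_of_sum: "rat_of (\<Sum>i\<in>S. f i) = (\<Sum>i\<in>S. rat_of (f i))"
  by (induction S rule: infinite_finite_induct) (simp_all add: rat_of_add)

lemma rat_of_prod: "rat_of (\<Prod>i\<in>S. f i) = (\<Prod>i\<in>S. rat_of (f i))"
  by (induction S rule: infinite_finite_induct) (simp_all add: rat_of_mult)

text \<open>By the quotient rule \<open>q d(\<eta>/q) = d\<eta> - (dq \<and> \<eta>)/q\<close>,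
  where \<open>d\<eta>\<close> is already polynomial.\<close>

lemma mult_ext_deriv_polynomial_iff:
  assumes "q \<noteq> 0" "\<And>j. rat_of q * \<omega> $ j = rat_of (\<eta> j)"
  shows "rat_of q * ext_deriv \<omega> $ i $ j \<in> range rat_of
    \<longleftrightarrow> q dvd \<eta> j * pdiff i q - \<eta> i * pdiff j q"
proof -
  have \<omega>: "\<omega> $ j = Fraction_Field.Fract (\<eta> j) q" for j
  proof -
    have "\<omega> $ j = rat_of (\<eta> j) / rat_of q"
      using assms by (simp add: field_simps flip: assms(2))
    then show ?thesis
      by (simp add: rat_of_def)
  qed
  define N where "N = (pdiff i (\<eta> j) - pdiff j (\<eta> i)) * q - (\<eta> j * pdiff i q - \<eta> i * pdiff j q)"
  have "rat_of q * ext_deriv \<omega> $ i $ j = rat_of N / rat_of q"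
    using assms(1) unfolding ext_deriv_def \<omega>
    by (simp add: rdiff_Fract rat_of_def eq_fract N_def algebra_simps)
  also have "\<dots> \<in> range rat_of \<longleftrightarrow> q dvd N"
    using assms(1) by (auto simp: field_simps dvd_def image_iff simp flip: rat_of_mult)
  also have "\<dots> \<longleftrightarrow> q dvd \<eta> j * pdiff i q - \<eta> i * pdiff j q"
    unfolding N_def by (metis dvd_triv_right dvd_diff_right_iff)
  finally show ?thesis .
qed

section \<open>Divided differences\<close>

text \<open>The sums obey the recursion of divided differences: \<open>(x a - x b) * D S\<close> is
  the difference of the sums with \<open>a\<close> and with \<open>b\<close> removed, and these
  agree by induction.\<close>

lemma sum_prod_inverse_diff:
  fixes x :: "'a \<Rightarrow> 'b::field"
  assumes "finite S" "S \<noteq> {}" "inj_on x S"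
  shows "(\<Sum>j\<in>S. \<Prod>k\<in>S - {j}. 1 / (x k - x j)) = (if is_singleton S then 1 else 0)"
  using assms
proof (induction "card S" arbitrary: S rule: less_induct)
  case less
  show ?case
  proof (cases "is_singleton S")
    case True
    then show ?thesis by (auto simp: is_singleton_def)
  next
    case False
    then obtain a b where ab: "a \<in> S" "b \<in> S" "a \<noteq> b"
      using less.prems by (metis is_singletonI')
    define D where "D S = (\<Sum>j\<in>S. \<Prod>k\<in>S - {j}. 1 / (x k - x j))" for S
    define R where "R = S - {a, b}"
    have S: "S = insert a (insert b R)" and R: "a \<notin> R" "b \<notin> R" "finite R"
      using ab less.prems by (auto simp: R_def)
    have x: "x i = x j \<longleftrightarrow> i = j" if "i \<in> S" "j \<in> S" for i j
      using that less.prems by (auto simp: inj_on_def)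
    let ?t = "\<lambda>j. \<Prod>k\<in>R - {j}. 1 / (x k - x j)"
    have 1: "D S = (\<Sum>j\<in>R. 1 / (x a - x j) * (1 / (x b - x j)) * ?t j)
      + 1 / (x b - x a) * ?t a + 1 / (x a - x b) * ?t b"
    proof -
      have "S - {j} = insert a (insert b (R - {j}))" if "j \<in> R" for j
        using that R by (auto simp: S)
      moreover have "S - {a} = insert b (R - {a})" "S - {b} = insert a (R - {b})"
        using R ab by (auto simp: S)
      ultimately show ?thesis
        using R ab(3) unfolding D_def by (simp add: S algebra_simps)
    qed
    have 2: "D (insert c R) = (\<Sum>j\<in>R. 1 / (x c - x j) * ?t j) + ?t c" if "c \<notin> R" for c
    proof -
      have "insert c R - {j} = insert c (R - {j})" if "j \<in> R" for j
        using that \<open>c \<notin> R\<close> by auto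
      moreover have "insert c R - {c} = R - {c}" by auto
      ultimately show ?thesis
        using R that unfolding D_def by simp
    qed
    have "(x a - x b) * D S = D (insert b R) - D (insert a R)"
    proof -
      \<comment> \<open>Partial fractions split each term over \<open>R\<close> into one term of
        either smaller sum.\<close>
      have "(x a - x b) * (1 / (x a - x j) * (1 / (x b - x j)) * ?t j)
          = 1 / (x b - x j) * ?t j - 1 / (x a - x j) * ?t j" if "j \<in> R" for j
      proof -
        have "x a - x j \<noteq> 0" "x b - x j \<noteq> 0"
          using x that S R by auto
        then show ?thesis by (simp add: divide_simps) (simp add: algebra_simps)
      qed
      moreover have "x a - x b \<noteq> 0" "x b - x a \<noteq> 0"
        using x ab by auto
      moreover from this have "(x a - x b) * (1 / (x b - x a) * ?t a) = - ?t a"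
        "(x a - x b) * (1 / (x a - x b) * ?t b) = ?t b"
        by (simp_all add: field_simps)
      ultimately show ?thesis
        using R unfolding 1 by (simp add: 2 distrib_left sum_distrib_left sum_subtractf)
    qed
    \<comment> \<open>Both sets have the same size, so the induction hypothesis gives both sums the
      same value.\<close>
    also have "D (insert b R) = D (insert a R)"
    proof -
      have inj: "inj_on x (insert c R)" if "c \<in> S" for c
        using less.prems(3) by (rule inj_on_subset) (use that S in auto)
      have *: "D (insert c R) = (if is_singleton (insert c R) then 1 else 0)"
        if "c \<in> S" "c \<notin> R" for c
        unfolding D_def by (rule less.hyps) (use that R inj ab in \<open>auto simp: S\<close>)
      have "is_singleton (insert c R) \<longleftrightarrow> R = {}" if "c \<notin> R" for c
        using that by (auto simp: is_singleton_def)
      then show ?thesis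
        using * ab R by simp
    qed
    finally show ?thesis
      using x ab False by (simp add: D_def)
  qed
qed

section \<open>Finite bases\<close>

text \<open>Reduces statements about the set \<open>range b\<close> to coefficient families over the
  finite index type.\<close>

lemma (in module) family_basisI:
  fixes b :: "'i::finite \<Rightarrow> 'b"
  assumes "subspace M" "\<And>i. b i \<in> M"
    and span: "\<And>x. x \<in> M \<Longrightarrow> \<exists>c. x = (\<Sum>i\<in>UNIV. scale (c i) (b i))"
    and indep: "\<And>c i. (\<Sum>i\<in>UNIV. scale (c i) (b i)) = 0 \<Longrightarrow> c i = 0"
  shows "family_basis b M"
proof -
  have inj: "inj b"
  proof (rule injI, rule ccontr)
    fix i j assume ij: "b i = b j" "i \<noteq> j"
    \<comment> \<open>Equal members would satisfy the nontrivial relation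
      \<open>b i - b j = 0\<close>.\<close>
    let ?c = "\<lambda>k. if k = i then 1 else if k = j then - 1 else 0"
    have "(\<Sum>k\<in>UNIV. scale (?c k) (b k)) = (\<Sum>k\<in>{i, j}. scale (?c k) (b k))"
      by (rule sum.mono_neutral_right) auto
    also have "\<dots> = 0"
      using ij by simp
    finally show False
      using indep[of ?c i] by simp
  qed
  moreover have "independent (range b)"
  proof -
    have "u (b i) = 0" if "(\<Sum>v\<in>range b. scale (u v) v) = 0" for u i
      using that inj indep[of "u \<circ> b" i] by (simp add: sum.reindex)
    then show ?thesis
      by (auto simp: dependent_finite)
  qed
  moreover have "span (range b) = M"
  proof
    show "span (range b) \<subseteq> M"
      using assms by (intro span_minimal) auto
    show "M \<subseteq> span (range b)"
    proof
      fix x assume "x \<in> M"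
      then obtain c where "x = (\<Sum>i\<in>UNIV. scale (c i) (b i))"
        using span by blast
      then show "x \<in> span (range b)"
        by (simp add: span_sum span_scale span_base)
    qed
  qed
  ultimately show ?thesis
    by (simp add: family_basis_def)
qed

section \<open>Logarithmic forms of a tree arrangement\<close>

locale tree =
  fixes T :: "'i::finite rel"
  assumes tree_order: "tree_order T"
begin

section \<open>Order theory of the tree\<close>

lemma partial_order: "partial_order_on UNIV T"
  using tree_order by (simp add: tree_order_def)

lemma refl [simp]: "(i, i) \<in> T"
  using partial_order by (auto simp: partial_order_on_def preorder_on_def refl_on_def)

lemma trans: "\<lbrakk>(i, j) \<in> T; (j, k) \<in> T\<rbrakk> \<Longrightarrow> (i, k) \<in> T"
  using partial_order by (auto simp: partial_order_on_def preorder_on_def dest: transD)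

lemma antisym: "\<lbrakk>(i, j) \<in> T; (j, i) \<in> T\<rbrakk> \<Longrightarrow> i = j"
  using partial_order by (auto simp: partial_order_on_def dest: antisymD)

text \<open>The unique minimal element is a least one, because by finiteness every descent ends in a
  minimal element. Hence the interval from the root to \<open>i\<close> contains everything below
  \<open>i\<close>, and it is a chain.\<close>

lemma comparable:
  assumes "(j, i) \<in> T" "(k, i) \<in> T"
  shows "(j, k) \<in> T \<or> (k, j) \<in> T"
proof -
  obtain r where r: "minimal_in T r" "\<And>s. minimal_in T s \<Longrightarrow> s = r"
    using tree_order unfolding tree_order_def by blast
  have "wf (T - Id)"
    using partial_order by (intro partial_order_on_well_order_on) auto
  then have root: "(r, k) \<in> T" for k
  proof (induction k)
    case (less k)
    show ?case
    proof (cases "minimal_in T k")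
      case True
      then show ?thesis using r(2) by auto
    next
      case False
      then show ?thesis using less trans by (auto simp: minimal_in_def)
    qed
  qed
  have "{k. (r, k) \<in> T \<and> (k, i) \<in> T} \<in> Chains T"
    using tree_order r(1) by (simp add: tree_order_def)
  with assms root show ?thesis
    by (simp add: Chains_def)
qed

section \<open>The defining polynomial\<close>

text \<open>By antisymmetry no hyperplane is listed in both orientations, so the factors of
  \<open>Q_poly T\<close> are pairwise non-associated.\<close>

lemma inj_doubleton: "inj_on (\<lambda>p. {fst p, snd p}) {(i, j). (i, j) \<in> T \<and> i \<noteq> j}"
  using antisym by (auto simp: inj_on_def doubleton_eq_iff)

lemma Q_poly_dvd:
  assumes "\<And>a b. \<lbrakk>(a, b) \<in> T; a \<noteq> b\<rbrakk> \<Longrightarrow> Var a - Var b dvd p"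
  shows "Q_poly T dvd p"
  using prod_diff_Var_dvd[OF _ inj_doubleton, of p] assms
  by (auto simp: Q_poly_def case_prod_beta)

lemma Q_poly_nonzero: "Q_poly T \<noteq> 0"
  by (auto simp: Q_poly_def)

text \<open>Square-freeness at one hyperplane; it allows the cofactor \<open>q\<close> to be
  cancelled modulo \<open>Var a - Var b\<close>.\<close>

lemma Q_poly_factor:
  assumes "(a, b) \<in> T" "a \<noteq> b"
  obtains q where "Q_poly T = (Var a - Var b) * q" "\<not> Var a - Var b dvd q"
proof
  let ?S = "{(i, j). (i, j) \<in> T \<and> i \<noteq> j} - {(a, b)}"
  show "Q_poly T = (Var a - Var b) * (\<Prod>(i, j)\<in>?S. Var i - Var j)"
    using assms unfolding Q_poly_def by (subst prod.remove[of _ "(a, b)"]) auto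
  show "\<not> Var a - Var b dvd (\<Prod>(i, j)\<in>?S. Var i - Var j)"
    using assms antisym
    by (auto simp: diff_Var_dvd_prod_iff diff_Var_dvd_diff_Var_iff doubleton_eq_iff)
qed

lemma diff_Var_dvd_Q_poly: "\<lbrakk>(a, b) \<in> T; a \<noteq> b\<rbrakk> \<Longrightarrow> Var a - Var b dvd Q_poly T"
  by (auto elim: Q_poly_factor)

text \<open>Encodes that \<open>\<Sum> \<eta>\<^sub>j dx\<^sub>j\<close> is a multiple of
  \<open>dx\<^sub>a - dx\<^sub>b\<close> modulo each \<open>x\<^sub>a - x\<^sub>b\<close>.\<close>

definition log_numerators :: "('i \<Rightarrow> 'i cpoly) \<Rightarrow> bool" where
  "log_numerators \<eta> \<longleftrightarrow> (\<forall>a b. (a, b) \<in> T \<and> a \<noteq> b \<longrightarrow>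
    (\<forall>j. j \<noteq> a \<and> j \<noteq> b \<longrightarrow> Var a - Var b dvd \<eta> j) \<and> Var a - Var b dvd \<eta> a + \<eta> b)"

text \<open>Write \<open>\<omega> = \<eta>/Q\<close> and \<open>\<alpha> = x\<^sub>a - x\<^sub>b\<close>. Then \<open>Q d\<omega>\<close> is polynomial iff \<open>Q\<close> divides
  \<open>dQ \<and> \<eta>\<close>, iff every \<open>\<alpha>\<close> divides \<open>d\<alpha> \<and> \<eta>\<close>, since \<open>dQ \<equiv> (Q/\<alpha>) d\<alpha>\<close> modulo \<open>\<alpha>\<close>
  and \<open>\<alpha>\<close> is prime to \<open>Q/\<alpha>\<close>.\<close>

lemma log_numerators_iff:
  "log_numerators \<eta> \<longleftrightarrow>
    (\<forall>i j. Q_poly T dvd \<eta> j * pdiff i (Q_poly T) - \<eta> i * pdiff j (Q_poly T))"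
proof -
  let ?Q = "Q_poly T"
  have local_iff: "Var a - Var b dvd \<eta> j * pdiff i ?Q - \<eta> i * pdiff j ?Q \<longleftrightarrow>
      Var a - Var b dvd \<eta> j * pdiff i (Var a - Var b) - \<eta> i * pdiff j (Var a - Var b)"
    if ab: "(a, b) \<in> T" "a \<noteq> b" for a b i j
  proof -
    obtain q where q: "?Q = (Var a - Var b) * q" "\<not> Var a - Var b dvd q"
      using Q_poly_factor[OF ab] .
    have "\<eta> j * pdiff i ?Q - \<eta> i * pdiff j ?Q
      = (Var a - Var b) * (\<eta> j * pdiff i q - \<eta> i * pdiff j q)
        + (\<eta> j * pdiff i (Var a - Var b) - \<eta> i * pdiff j (Var a - Var b)) * q"
      unfolding q(1) pdiff_mult by (simp add: algebra_simps)
    then show ?thesis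
      using q(2) ab by (simp add: diff_Var_dvd_mult_iff dvd_add_right_iff)
  qed
  have "(\<forall>i j. ?Q dvd \<eta> j * pdiff i ?Q - \<eta> i * pdiff j ?Q) \<longleftrightarrow>
    (\<forall>a b. (a, b) \<in> T \<and> a \<noteq> b \<longrightarrow> (\<forall>i j.
      Var a - Var b dvd \<eta> j * pdiff i (Var a - Var b) - \<eta> i * pdiff j (Var a - Var b)))"
    (is "?L \<longleftrightarrow> ?R")
  proof
    assume ?R
    then show ?L
      by (auto intro!: Q_poly_dvd simp: local_iff)
  next
    assume ?L
    then show ?R
      using local_iff dvd_trans[OF diff_Var_dvd_Q_poly] by blast
  qed
  also have "\<dots> \<longleftrightarrow> log_numerators \<eta>"
  proof -
    have "(\<forall>i j. Var a - Var b dvd \<eta> j * pdiff i (Var a - Var b) - \<eta> i * pdiff j (Var a - Var b))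
      \<longleftrightarrow> (\<forall>j. j \<noteq> a \<and> j \<noteq> b \<longrightarrow> Var a - Var b dvd \<eta> j) \<and> Var a - Var b dvd \<eta> a + \<eta> b"
      (is "?L \<longleftrightarrow> ?R") if "a \<noteq> b" for a b
    proof
      assume L: ?L
      \<comment> \<open>The index \<open>i = a\<close> isolates \<open>\<eta> j\<close>: the
        derivative of \<open>x\<^sub>a - x\<^sub>b\<close> is \<open>1\<close> in direction
        \<open>a\<close> and \<open>0\<close> in direction \<open>j\<close>.\<close>
      have "Var a - Var b dvd \<eta> j" if "j \<noteq> a" "j \<noteq> b" for j
        using L[rule_format, where i = a and j = j] that \<open>a \<noteq> b\<close> by (simp add: pdiff_diff_Var)
      moreover have "Var a - Var b dvd \<eta> a + \<eta> b"
        using L[rule_format, where i = a and j = b] \<open>a \<noteq> b\<close>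
        by (simp add: pdiff_diff_Var add.commute)
      ultimately show ?R by blast
    next
      assume R: ?R
      \<comment> \<open>The coefficient at \<open>(b, a)\<close>, opposite to the one at
        \<open>(a, b)\<close>.\<close>
      have neg: "Var a - Var b dvd - \<eta> a - \<eta> b"
        using R by (metis dvd_minus_iff minus_add_distrib uminus_add_conv_diff add.commute)
      show ?L
      proof (intro allI)
        fix i j
        show "Var a - Var b dvd
            \<eta> j * pdiff i (Var a - Var b) - \<eta> i * pdiff j (Var a - Var b)"
          using R neg that by (auto simp: pdiff_diff_Var add.commute)
      qed
    qed
    then show ?thesis
      by (auto simp: log_numerators_def)
  qed
  finally show ?thesis by simp
qed

text \<open>With \<open>log_formE\<close>, this replaces logarithmic forms by their numerators, so
  that no derivatives occur from here on.\<close>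

lemma log_formI:
  assumes "\<And>j. rat_of (Q_poly T) * \<omega> $ j = rat_of (\<eta> j)" "log_numerators \<eta>"
  shows "\<omega> \<in> log_forms T"
  unfolding log_forms_def
  using assms(2) mult_ext_deriv_polynomial_iff[OF Q_poly_nonzero assms(1)]
  by (auto simp: assms(1) log_numerators_iff)

lemma log_formE:
  assumes "\<omega> \<in> log_forms T"
  obtains \<eta> where "\<And>j. rat_of (Q_poly T) * \<omega> $ j = rat_of (\<eta> j)" "log_numerators \<eta>"
proof -
  have "\<forall>j. \<exists>p. rat_of (Q_poly T) * \<omega> $ j = rat_of p"
    using assms by (auto simp: log_forms_def)
  then obtain \<eta> where \<eta>: "\<And>j. rat_of (Q_poly T) * \<omega> $ j = rat_of (\<eta> j)"
    by metis
  moreover have "log_numerators \<eta>"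
    using assms mult_ext_deriv_polynomial_iff[OF Q_poly_nonzero \<eta>]
    by (simp add: log_numerators_iff log_forms_def)
  ultimately show thesis by (rule that)
qed

lemma subspace_log_forms: "form.subspace (log_forms T)"
proof (rule form.subspaceI)
  show "0 \<in> log_forms T"
    by (rule log_formI[of _ "\<lambda>_. 0"]) (simp_all add: log_numerators_def)
next
  fix \<omega> \<omega>' assume "\<omega> \<in> log_forms T" "\<omega>' \<in> log_forms T"
  then obtain \<eta> \<eta>'
    where \<eta>: "\<And>j. rat_of (Q_poly T) * \<omega> $ j = rat_of (\<eta> j)" "log_numerators \<eta>"
    and \<eta>': "\<And>j. rat_of (Q_poly T) * \<omega>' $ j = rat_of (\<eta>' j)" "log_numerators \<eta>'"
    by (metis log_formE)
  have "Var a - Var b dvd \<eta> a + \<eta>' a + (\<eta> b + \<eta>' b)" if "(a, b) \<in> T" "a \<noteq> b" for a b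
  proof -
    have "Var a - Var b dvd (\<eta> a + \<eta> b) + (\<eta>' a + \<eta>' b)"
      using \<eta>(2) \<eta>'(2) that by (auto simp: log_numerators_def intro: dvd_add)
    then show ?thesis by (simp add: ac_simps)
  qed
  then show "\<omega> + \<omega>' \<in> log_forms T"
    using \<eta> \<eta>' by (intro log_formI[of _ "\<lambda>j. \<eta> j + \<eta>' j"])
      (auto simp: distrib_left rat_of_add log_numerators_def)
next
  fix p \<omega> assume "\<omega> \<in> log_forms T"
  then obtain \<eta> where \<eta>: "\<And>j. rat_of (Q_poly T) * \<omega> $ j = rat_of (\<eta> j)" "log_numerators \<eta>"
    using log_formE by blast
  have "rat_of (Q_poly T) * form_scale p \<omega> $ j = rat_of (p * \<eta> j)" for j
    by (simp add: form_scale_def rat_of_mult mult.left_commute flip: \<eta>(1))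
  then show "form_scale p \<omega> \<in> log_forms T"
    using \<eta>(2) by (intro log_formI[of _ "\<lambda>j. p * \<eta> j"])
      (auto simp: log_numerators_def simp flip: distrib_left)
qed

section \<open>The forms \<open>omega\<close> are logarithmic\<close>

text \<open>Elements below \<open>m\<close> are pairwise comparable, so each denominator in
  \<open>omega T m\<close> is, up to sign, a product of distinct factors of
  \<open>Q_poly T\<close>.\<close>

lemma omega_numerator:
  obtains \<eta> where "\<And>j. rat_of (Q_poly T) * omega T m $ j = rat_of (\<eta> j)"
    and "\<And>j. (j, m) \<notin> T \<Longrightarrow> \<eta> j = 0"
    and "\<And>j. (j, m) \<in> T \<Longrightarrow>
      (\<Prod>k | (k, m) \<in> T \<and> k \<noteq> j. Var k - Var j) * \<eta> j = Q_poly T"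
proof -
  define P where "P j = (\<Prod>k | (k, m) \<in> T \<and> k \<noteq> j. Var k - Var j)" for j
  have P_dvd: "P j dvd Q_poly T" if "(j, m) \<in> T" for j
    unfolding P_def
  proof (rule prod_diff_Var_dvd[where u = "\<lambda>k. k" and v = "\<lambda>_. j"])
    fix k assume "k \<in> {k. (k, m) \<in> T \<and> k \<noteq> j}"
    then have "(k, j) \<in> T \<or> (j, k) \<in> T" "k \<noteq> j"
      using that comparable by auto
    \<comment> \<open>If \<open>j\<close> lies below \<open>k\<close>, then \<open>Q_poly T\<close>
      contains the negative of this factor.\<close>
    then show "Var k - Var j dvd Q_poly T"
      using diff_Var_dvd_Q_poly minus_dvd_iff[of "Var j - Var k" "Q_poly T"] by auto
  qed (auto simp: inj_on_def doubleton_eq_iff)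
  have "\<forall>j. \<exists>p. (j, m) \<in> T \<longrightarrow> P j * p = Q_poly T"
    using P_dvd by (metis dvd_def)
  then obtain \<eta>0 where \<eta>0: "\<And>j. (j, m) \<in> T \<Longrightarrow> P j * \<eta>0 j = Q_poly T"
    by metis
  let ?\<eta> = "\<lambda>j. if (j, m) \<in> T then \<eta>0 j else 0"
  have "rat_of (Q_poly T) * omega T m $ j = rat_of (?\<eta> j)" for j
  proof (cases "(j, m) \<in> T")
    case True
    have "rat_of (P j) \<noteq> 0"
      by (simp add: P_def)
    moreover have "omega T m $ j = 1 / rat_of (P j)"
      using True by (simp add: omega_def P_def rat_of_prod rat_of_diff prod_dividef)
    ultimately show ?thesis
      using True by (simp add: rat_of_mult flip: \<eta>0[OF True])
  qed (simp add: omega_def)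
  then show thesis
    by (rule that) (use \<eta>0 in \<open>auto simp: P_def\<close>)
qed

text \<open>Only the coefficients at \<open>a\<close> and \<open>b\<close> can have a pole along
  \<open>x\<^sub>a = x\<^sub>b\<close>, and only if both points lie below \<open>m\<close>. In that
  case the two residues cancel.\<close>

lemma omega_in_log_forms: "omega T m \<in> log_forms T"
proof -
  obtain \<eta> where \<eta>: "\<And>j. rat_of (Q_poly T) * omega T m $ j = rat_of (\<eta> j)"
      "\<And>j. (j, m) \<notin> T \<Longrightarrow> \<eta> j = 0"
      "\<And>j. (j, m) \<in> T \<Longrightarrow> (\<Prod>k | (k, m) \<in> T \<and> k \<noteq> j. Var k - Var j) * \<eta> j = Q_poly T"
    using omega_numerator[of m] by blast
  have "log_numerators \<eta>"
    unfolding log_numerators_def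
  proof (intro allI impI, elim conjE)
    fix a b assume ab: "(a, b) \<in> T" "a \<noteq> b"
    let ?\<sigma> = "identify a b"
    obtain q where q: "Q_poly T = (Var a - Var b) * q"
      using Q_poly_factor[OF ab] .
    \<comment> \<open>Under this hypothesis the denominator at \<open>j\<close> lacks the prime
      \<open>Var a - Var b\<close>, so the prime must divide \<open>\<eta> j\<close>.\<close>
    have no_pole: "?\<sigma> (\<eta> j) = 0" if "\<And>k. (k, m) \<in> T \<Longrightarrow> {a, b} \<noteq> {k, j}" for j
    proof (cases "(j, m) \<in> T")
      case True
      have "Var a - Var b dvd (\<Prod>k | (k, m) \<in> T \<and> k \<noteq> j. Var k - Var j) * \<eta> j"
        by (simp add: \<eta>(3)[OF True] q)
      then have "Var a - Var b dvd \<eta> j"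
        using that ab(2)
        by (auto simp: diff_Var_dvd_mult_iff diff_Var_dvd_prod_iff diff_Var_dvd_diff_Var_iff)
      then show ?thesis
        using ab(2) by (simp add: diff_Var_dvd_iff)
    qed (simp add: \<eta>(2))
    have "?\<sigma> (\<eta> j) = 0" if "j \<noteq> a" "j \<noteq> b" for j
      by (rule no_pole) (use that in auto)
    moreover have "?\<sigma> (\<eta> a + \<eta> b) = 0"
    proof (cases "(b, m) \<in> T")
      case False
      then have "?\<sigma> (\<eta> a) = 0"
        by (intro no_pole) (auto simp: doubleton_eq_iff ab(2))
      with False show ?thesis
        by (simp add: \<eta>(2) identify_add)
    next
      case True
      then have a: "(a, m) \<in> T"
        using ab(1) trans by blast
      define R where "R = {k. (k, m) \<in> T} - {a, b}"
      let ?P = "\<lambda>j. \<Prod>k\<in>R. Var k - Var j"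
      have "{k. (k, m) \<in> T \<and> k \<noteq> a} = insert b R" "{k. (k, m) \<in> T \<and> k \<noteq> b} = insert a R"
        "a \<notin> R" "b \<notin> R"
        using True a ab(2) by (auto simp: R_def)
      then have "(\<Prod>k | (k, m) \<in> T \<and> k \<noteq> a. Var k - Var a) = (Var b - Var a) * ?P a"
        "(\<Prod>k | (k, m) \<in> T \<and> k \<noteq> b. Var k - Var b) = (Var a - Var b) * ?P b"
        by simp_all
      with \<eta>(3)[OF a] \<eta>(3)[OF True]
      \<comment> \<open>Both sides equal \<open>Q_poly T\<close>.\<close>
      have "(Var b - Var a) * ?P a * \<eta> a = (Var a - Var b) * ?P b * \<eta> b"
        by (simp only:)
      then have "(Var a - Var b) * (?P a * \<eta> a + ?P b * \<eta> b) = 0"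
        by (simp add: algebra_simps)
      then have "?P a * \<eta> a + ?P b * \<eta> b = 0"
        using ab(2) by simp
      then have "?\<sigma> (?P a) * ?\<sigma> (\<eta> a) + ?\<sigma> (?P b) * ?\<sigma> (\<eta> b) = 0"
        by (metis identify_add identify_mult identify_zero)
      \<comment> \<open>\<open>R\<close> avoids \<open>a\<close> and \<open>b\<close>, so the
        substitution affects only the subtracted variable.\<close>
      moreover have "?\<sigma> (?P a) = ?P b" "?\<sigma> (?P b) = ?P b"
        using ab(2) by (auto simp: identify_prod identify_diff identify_Var R_def intro!: prod.cong)
      ultimately have "?P b * ?\<sigma> (\<eta> a + \<eta> b) = 0"
        by (simp add: identify_add distrib_left)
      moreover have "?P b \<noteq> 0"
        by (auto simp: R_def)
      ultimately show ?thesis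
        by simp
    qed
    ultimately show "(\<forall>j. j \<noteq> a \<and> j \<noteq> b \<longrightarrow> Var a - Var b dvd \<eta> j) \<and> Var a - Var b dvd \<eta> a + \<eta> b"
      using ab(2) by (simp add: diff_Var_dvd_iff)
  qed
  with \<eta>(1) show ?thesis
    by (rule log_formI)
qed

section \<open>Duality\<close>

lemma apply_vf_diff_Var: "apply_vf \<theta> (Var a - Var b) = \<theta> $ a - \<theta> $ b"
proof -
  have "\<theta> $ j * ((if j = a then 1 else 0) - (if j = b then 1 else 0))
    = (if j = a then \<theta> $ j else 0) - (if j = b then \<theta> $ j else 0)" for j
    by simp
  then show ?thesis
    by (simp add: apply_vf_def pdiff_diff_Var sum_subtractf)
qed

lemma Der_iff: "\<theta> \<in> Der T \<longleftrightarrow> (\<forall>a b. (a, b) \<in> T \<and> a \<noteq> b \<longrightarrow> Var a - Var b dvd \<theta> $ a - \<theta> $ b)"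
  by (simp add: Der_def apply_vf_diff_Var)

lemma subspace_Der: "vf.subspace (Der T)"
proof (rule vf.subspaceI)
  fix \<theta> \<theta>' assume *: "\<theta> \<in> Der T" "\<theta>' \<in> Der T"
  have "Var a - Var b dvd (\<theta> $ a + \<theta>' $ a) - (\<theta> $ b + \<theta>' $ b)" if "(a, b) \<in> T" "a \<noteq> b" for a b
    using dvd_add[of "Var a - Var b" "\<theta> $ a - \<theta> $ b" "\<theta>' $ a - \<theta>' $ b"] * that
    by (simp add: Der_iff algebra_simps)
  then show "\<theta> + \<theta>' \<in> Der T"
    by (simp add: Der_iff)
qed (auto simp: Der_iff simp flip: right_diff_distrib)

text \<open>If \<open>m\<close> is below \<open>a\<close>, both coefficients are the same product
  once \<open>x\<^sub>a = x\<^sub>b\<close>. If \<open>m\<close> is below \<open>b\<close> only,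
  then \<open>a\<close> is strictly below \<open>m\<close> and supplies the factor
  \<open>x\<^sub>a - x\<^sub>b\<close>. Otherwise both vanish.\<close>

lemma theta_in_Der: "theta T m \<in> Der T"
  unfolding Der_iff
proof (intro allI impI, elim conjE)
  fix a b assume ab: "(a, b) \<in> T" "a \<noteq> b"
  consider "(m, a) \<in> T" | "(m, b) \<in> T" "(m, a) \<notin> T" | "(m, b) \<notin> T" by blast
  then show "Var a - Var b dvd theta T m $ a - theta T m $ b"
  proof cases
    case 1
    then have "(m, b) \<in> T" using ab trans by blast
    moreover have "(k, m) \<in> T \<and> k \<noteq> m \<longrightarrow> k \<noteq> a" for k
      using 1 antisym by blast
    ultimately show ?thesis
      using ab 1 by (auto simp: theta_def diff_Var_dvd_iff identify_diff identify_prod identify_Var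
        intro!: prod.cong)
  next
    case 2
    then have "(a, m) \<in> T" "a \<noteq> m"
      using comparable[of a b m] ab by auto
    then have "Var a - Var b dvd (\<Prod>k | (k, m) \<in> T \<and> k \<noteq> m. Var k - Var b)"
      using ab by (auto simp: diff_Var_dvd_prod_iff)
    then show ?thesis
      using 2 by (simp add: theta_def)
  next
    case 3
    then show ?thesis using ab trans by (auto simp: theta_def)
  qed
qed

text \<open>Modulo \<open>x\<^sub>a - x\<^sub>b\<close> only the terms at \<open>a\<close> and
  \<open>b\<close> survive. They regroup into a multiple of \<open>\<eta> a + \<eta> b\<close> and
  one of \<open>\<theta> $ a - \<theta> $ b\<close>, both divisible.\<close>

lemma pairing_polynomial:
  assumes "\<omega> \<in> log_forms T" "\<theta> \<in> Der T"
  shows "pairing \<omega> \<theta> \<in> range rat_of"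
proof -
  obtain \<eta> where \<eta>: "\<And>j. rat_of (Q_poly T) * \<omega> $ j = rat_of (\<eta> j)" "log_numerators \<eta>"
    using log_formE[OF assms(1)] by blast
  have "Q_poly T dvd (\<Sum>j\<in>UNIV. \<eta> j * \<theta> $ j)"
  proof (rule Q_poly_dvd)
    fix a b assume ab: "(a, b) \<in> T" "a \<noteq> b"
    have "(\<Sum>j\<in>UNIV. \<eta> j * \<theta> $ j)
      = (\<Sum>j\<in>- {a, b}. \<eta> j * \<theta> $ j) + (\<Sum>j\<in>{a, b}. \<eta> j * \<theta> $ j)"
      unfolding Compl_eq_Diff_UNIV by (rule sum.subset_diff) auto
    also have "(\<Sum>j\<in>{a, b}. \<eta> j * \<theta> $ j)
      = (\<eta> a + \<eta> b) * \<theta> $ a - \<eta> b * (\<theta> $ a - \<theta> $ b)"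
      using ab by (simp add: algebra_simps)
    finally have "(\<Sum>j\<in>UNIV. \<eta> j * \<theta> $ j) = (\<Sum>j\<in>- {a, b}. \<eta> j * \<theta> $ j)
      + ((\<eta> a + \<eta> b) * \<theta> $ a - \<eta> b * (\<theta> $ a - \<theta> $ b))" .
    moreover have "Var a - Var b dvd (\<Sum>j\<in>- {a, b}. \<eta> j * \<theta> $ j)"
      using \<eta>(2) ab by (intro dvd_sum dvd_mult2) (auto simp: log_numerators_def)
    moreover have "Var a - Var b dvd \<eta> a + \<eta> b" "Var a - Var b dvd \<theta> $ a - \<theta> $ b"
      using \<eta>(2) assms(2) ab by (auto simp: log_numerators_def Der_iff)
    ultimately show "Var a - Var b dvd (\<Sum>j\<in>UNIV. \<eta> j * \<theta> $ j)"
      by (simp only: dvd_add dvd_diff dvd_mult dvd_mult2)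
  qed
  then obtain p where p: "(\<Sum>j\<in>UNIV. \<eta> j * \<theta> $ j) = Q_poly T * p" ..
  have "rat_of (Q_poly T) * pairing \<omega> \<theta> = rat_of (\<Sum>j\<in>UNIV. \<eta> j * \<theta> $ j)"
    by (simp add: pairing_def sum_distrib_left rat_of_sum rat_of_mult flip: mult.assoc \<eta>(1))
  then have "pairing \<omega> \<theta> = rat_of p"
    using Q_poly_nonzero by (simp add: p rat_of_mult)
  then show ?thesis by simp
qed

lemma pairing_omega_theta: "pairing (omega T i) (theta T i') = (if i = i' then 1 else 0)"
proof (cases "(i', i) \<in> T")
  case False
  then have "omega T i $ j * rat_of (theta T i' $ j) = 0" for j
    using trans by (auto simp: omega_def theta_def)
  then have "pairing (omega T i) (theta T i') = 0"
    unfolding pairing_def by (intro sum.neutral) simp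
  with False show ?thesis
    by auto
next
  case True
  let ?S = "{j. (i', j) \<in> T \<and> (j, i) \<in> T}"
  let ?x = "\<lambda>j. rat_of (Var j) :: 'i ratfun"
  have "omega T i $ j * rat_of (theta T i' $ j) = (\<Prod>k\<in>?S - {j}. 1 / (?x k - ?x j))"
    if j: "j \<in> ?S" for j
  proof -
    let ?B = "{k. (k, i') \<in> T \<and> k \<noteq> i'}"
    \<comment> \<open>The chain below \<open>i\<close> is cut at \<open>i'\<close>; the factors from
      \<open>?B\<close> will cancel against \<open>theta T i'\<close>.\<close>
    have "{k. (k, i) \<in> T \<and> k \<noteq> j} = ?B \<union> (?S - {j})"
    proof (intro set_eqI iffI)
      fix k assume "k \<in> {k. (k, i) \<in> T \<and> k \<noteq> j}"
      then show "k \<in> ?B \<union> (?S - {j})"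
        using comparable[of k i i'] True by auto
    next
      fix k assume "k \<in> ?B \<union> (?S - {j})"
      moreover have "k \<noteq> j" if "k \<in> ?B"
        using that j antisym by auto
      ultimately show "k \<in> {k. (k, i) \<in> T \<and> k \<noteq> j}"
        using trans[OF _ True] by auto
    qed
    moreover have "?B \<inter> (?S - {j}) = {}"
      using antisym by blast
    ultimately have "omega T i $ j
        = (\<Prod>k\<in>?B. 1 / (?x k - ?x j)) * (\<Prod>k\<in>?S - {j}. 1 / (?x k - ?x j))"
      using j by (simp add: omega_def prod.union_disjoint)
    moreover have "rat_of (theta T i' $ j) = (\<Prod>k\<in>?B. ?x k - ?x j)"
      using j by (simp add: theta_def rat_of_prod rat_of_diff)
    \<comment> \<open>No factor is zero, since \<open>k\<close> is strictly below \<open>i'\<close>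
      and \<open>i'\<close> is below \<open>j\<close>.\<close>
    moreover have "(\<Prod>k\<in>?B. 1 / (?x k - ?x j)) * (\<Prod>k\<in>?B. ?x k - ?x j) = 1"
      using j antisym by (auto simp flip: prod.distrib intro!: prod.neutral)
    ultimately show ?thesis
      by (simp add: ac_simps)
  qed
  moreover have "omega T i $ j * rat_of (theta T i' $ j) = 0" if "j \<notin> ?S" for j
    using that by (auto simp: omega_def theta_def)
  ultimately have "pairing (omega T i) (theta T i')
      = (\<Sum>j\<in>?S. \<Prod>k\<in>?S - {j}. 1 / (?x k - ?x j))"
    unfolding pairing_def by (intro sum.mono_neutral_cong_right) auto
  also have "\<dots> = (if is_singleton ?S then 1 else 0)"
    by (rule sum_prod_inverse_diff) (use True in \<open>auto simp: inj_on_def\<close>)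
  also have "is_singleton ?S \<longleftrightarrow> i = i'"
  proof
    assume "is_singleton ?S"
    moreover have "i \<in> ?S" "i' \<in> ?S"
      using True by auto
    ultimately show "i = i'"
      by (metis is_singletonE singletonD)
  next
    assume "i = i'"
    then have "?S = {i}"
      using antisym by auto
    then show "is_singleton ?S"
      by simp
  qed
  finally show ?thesis .
qed

text \<open>A one-sided inverse of a square matrix is two-sided.\<close>

lemma sum_omega_theta:
  "(\<Sum>i\<in>UNIV. rat_of (theta T i $ j) * omega T i $ k) = (if j = k then 1 else 0)"
proof -
  define W where "W = (\<chi> i j. omega T i $ j)"
  define V where "V = (\<chi> j i. rat_of (theta T i $ j))"
  have "W ** V = mat 1"
    using pairing_omega_theta
    by (auto simp: W_def V_def matrix_matrix_mult_def mat_def pairing_def vec_eq_iff)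
  then have "(V ** W) $ j $ k = mat 1 $ j $ k"
    by (simp add: matrix_left_right_inverse)
  then show ?thesis
    by (simp add: W_def V_def matrix_matrix_mult_def mat_def)
qed

section \<open>Expansion in the dual families\<close>

lemma theta_basis: "vf.family_basis (theta T) (Der T)"
proof (rule vf.family_basisI[OF subspace_Der theta_in_Der])
  fix \<theta> assume "\<theta> \<in> Der T"
  then have "\<forall>i. \<exists>p. pairing (omega T i) \<theta> = rat_of p"
    using pairing_polynomial[OF omega_in_log_forms] by blast
  then obtain c where c: "\<And>i. pairing (omega T i) \<theta> = rat_of (c i)"
    by metis
  have "rat_of (\<theta> $ j) = rat_of ((\<Sum>i\<in>UNIV. c i *s theta T i) $ j)" for j
  proof -
    have "rat_of ((\<Sum>i\<in>UNIV. c i *s theta T i) $ j)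
      = (\<Sum>i\<in>UNIV. \<Sum>k\<in>UNIV. rat_of (theta T i $ j) * omega T i $ k * rat_of (\<theta> $ k))"
      by (simp add: rat_of_sum rat_of_mult pairing_def sum_distrib_left ac_simps
        flip: c)
    \<comment> \<open>Exchanging the sums exposes the matrix product computed in
      \<open>sum_omega_theta\<close>.\<close>
    also have "\<dots> = (\<Sum>k\<in>UNIV. (\<Sum>i\<in>UNIV. rat_of (theta T i $ j) * omega T i $ k) * rat_of (\<theta> $ k))"
      by (subst sum.swap) (simp add: sum_distrib_right)
    also have "\<dots> = rat_of (\<theta> $ j)"
      by (simp add: sum_omega_theta if_distribR if_distrib cong: if_cong)
    finally show ?thesis by simp
  qed
  then show "\<exists>c. \<theta> = (\<Sum>i\<in>UNIV. c i *s theta T i)"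
    by (auto simp: vec_eq_iff)
next
  fix c i assume 0: "(\<Sum>i\<in>UNIV. c i *s theta T i) = 0"
  \<comment> \<open>Pairing the relation with \<open>omega T i\<close> reads off its coefficient
    \<open>c i\<close>.\<close>
  have "0 = pairing (omega T i) (\<Sum>i'\<in>UNIV. c i' *s theta T i')"
    by (simp add: 0 pairing_def)
  also have "\<dots> = (\<Sum>i'\<in>UNIV. rat_of (c i') * pairing (omega T i) (theta T i'))"
    by (simp add: pairing_def rat_of_sum rat_of_mult sum_distrib_left ac_simps) (rule sum.swap)
  also have "\<dots> = rat_of (c i)"
    by (simp add: pairing_omega_theta if_distrib cong: if_cong)
  finally show "c i = 0" by simp
qed

lemma omega_basis: "form.family_basis (omega T) (log_forms T)"
proof (rule form.family_basisI[OF subspace_log_forms omega_in_log_forms])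
  fix \<omega> assume "\<omega> \<in> log_forms T"
  \<comment> \<open>The same expansion with the two sides of the pairing exchanged.\<close>
  then have "\<forall>i. \<exists>p. pairing \<omega> (theta T i) = rat_of p"
    using pairing_polynomial[OF _ theta_in_Der] by blast
  then obtain c where c: "\<And>i. pairing \<omega> (theta T i) = rat_of (c i)"
    by metis
  have "\<omega> $ k = (\<Sum>i\<in>UNIV. form_scale (c i) (omega T i)) $ k" for k
  proof -
    have "(\<Sum>i\<in>UNIV. form_scale (c i) (omega T i)) $ k
      = (\<Sum>i\<in>UNIV. \<Sum>j\<in>UNIV. \<omega> $ j * (rat_of (theta T i $ j) * omega T i $ k))"
      by (simp add: form_scale_def pairing_def sum_distrib_right sum_distrib_left ac_simps
        flip: c)
    also have "\<dots> = (\<Sum>j\<in>UNIV. \<omega> $ j * (\<Sum>i\<in>UNIV. rat_of (theta T i $ j) * omega T i $ k))"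
      by (subst sum.swap) (simp add: sum_distrib_left)
    also have "\<dots> = \<omega> $ k"
      by (simp add: sum_omega_theta if_distrib cong: if_cong)
    finally show ?thesis by simp
  qed
  then show "\<exists>c. \<omega> = (\<Sum>i\<in>UNIV. form_scale (c i) (omega T i))"
    by (auto simp: vec_eq_iff)
next
  fix c i assume 0: "(\<Sum>i\<in>UNIV. form_scale (c i) (omega T i)) = 0"
  have "0 = pairing (\<Sum>i'\<in>UNIV. form_scale (c i') (omega T i')) (theta T i)"
    by (simp add: 0 pairing_def)
  also have "\<dots> = (\<Sum>i'\<in>UNIV. rat_of (c i') * pairing (omega T i') (theta T i))"
    by (simp add: pairing_def form_scale_def sum_distrib_right sum_distrib_left ac_simps)
      (rule sum.swap)
  also have "\<dots> = rat_of (c i)"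
    by (simp add: pairing_omega_theta if_distrib cong: if_cong)
  finally show "c i = 0" by simp
qed

end

theorem proposition3:
  fixes T :: "'i::finite rel"
  assumes "tree_order T"
  shows "vf.family_basis (theta T) (Der T) \<and>
    form.family_basis (omega T) (log_forms T) \<and>
    (\<forall>i i'. pairing (omega T i) (theta T i') = (if i = i' then 1 else 0))"
proof -
  interpret tree T
    by unfold_locales (rule assms)
  show ?thesis
    by (simp add: theta_basis omega_basis pairing_omega_theta)
qed

end
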